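(* Let $f\colon\mathbb{R}^n\to\mathbb{R}^m$ and $g\colon\mathbb{R}^n\to\mathbb{R}^p$ be continuous, let $D=\{x\in\mathbb{R}^n : g(x)\le 0\}$ and assume $D^o=\{x\in\mathbb{R}^n : g(x)<0\}\neq\emptyset$. Let $B\colon D^o\to\mathbb{R}^m_+$ be a multiobjective barrier function for $D$, let $\{\tau_k\}_{k\ge 1}\subset(0,+\infty)$ satisfy $\tau_{k+1}<\tau_k$ for all $k$ and $\tau_k\to 0$, and let $\Phi\colon\mathbb{R}^m\to\mathbb{R}$ be a continuous function that is $w$-increasing or $s$-increasing in $\mathbb{R}^m$. Assume that $$\inf_{x\in D^o}\Phi(f(x))=\inf_{x\in D}\Phi(f(x))\in\mathbb{R}.$$ Let $\{x^k\}_{k\ge1}\subset\mathbb{R}^n$ be a sequence such that $$x^k\in\mathop{\mathrm{argmin}}_{x\in D^o}\Phi\big(f(x)+\tau_kB(x)\big)\quad\text{for all }k=1,2,\dots$$ If $\bar x\in D$ is an accumulation point of $\{x^k\}$, then $\bar x\in\mathop{\mathrm{argmin}}_{x\in D}\Phi(f(x))$. Moreover, if $\Phi$ is $w$-increasing, then $\bar x$ is a weak Pareto optimal solution of the problem of minimizing $f(x)$ subject to $x\in D$; if $\Phi$ is $s$-increasing, then $\bar x$ is a Pareto optimal solution of this problem.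
   Context: Order: for $u,v$ in a Euclidean space, $u\le v$ means $u_j\le v_j$ for all $j$, and $u<v$ means $u_j<v_j$ for all $j$. $\mathbb{R}^m_+=[0,+\infty)^m$. Pareto notions, for the problem of minimizing $f$ subject to $x\in D$: a point $x^*\in D$ is a weak Pareto optimal solution if there is no $x\in D$ with $f(x)<f(x^* )$; it is a Pareto optimal solution if there is no $x\in D$ with $f(x)\le f(x^* )$ and $f_{j_0}(x)<f_{j_0}(x^* )$ for at least one index $j_0\in\{1,\dots,m\}$. Barrier: a multiobjective barrier function for $D$ is a continuous function $B\colon D^o\to\mathbb{R}^m_+$ such that for any sequence $\{z^k\}\subset D^o$ with $g_i(z^k)\to 0$ for an index $i\in\{1,\dots,p\}$, one has $\lim_{k\to\infty}B_{j_i}(z^k)=+\infty$ for at least one index $j_i\in\{1,\dots,m\}$. Monotonicity: $\Phi$ is $w$-increasing (weakly-increasing) in $\mathbb{R}^m$ if $u<v$ implies $\Phi(u)<\Phi(v)$ for all $u,v\in\mathbb{R}^m$. $\Phi$ is $s$-increasing (strongly increasing) in $\mathbb{R}^m$ if, for all $u,v\in\mathbb{R}^m$, $u\le v$ and $u_{j_0}<v_{j_0}$ for at least one $j_0$ imply $\Phi(u)<\Phi(v)$. The sequence $\{x^k\}$ described in the claim is the one generated by the multiobjective barrier method (MBM), in its weak version when $\Phi$ is $w$-increasing and its strong version when $\Phi$ is $s$-increasing. The existence of the minimizers $x^k$ is part of the hypothesis that such a sequence is given. *)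

theory Defs
  imports "HOL-Analysis.Analysis"
begin

(* The library's < on real ^ 'n is the strict part of the componentwise order
   (u \<le> v and not v \<le> u). Here strict inequality between vectors has to hold
   in every component, hence a separate relation. The library's \<le> is already
   the componentwise one. *)

definition vec_less :: "real ^ 'n \<Rightarrow> real ^ 'n \<Rightarrow> bool" where
  "vec_less u v \<longleftrightarrow> (\<forall>j. u $ j < v $ j)"

definition feasible :: "(real ^ 'n \<Rightarrow> real ^ 'p) \<Rightarrow> (real ^ 'n) set" where
  "feasible g = {x. g x \<le> 0}"

definition strictly_feasible :: "(real ^ 'n \<Rightarrow> real ^ 'p) \<Rightarrow> (real ^ 'n) set" where
  "strictly_feasible g = {x. vec_less (g x) 0}"

definition weak_pareto_optimal ::
    "(real ^ 'n \<Rightarrow> real ^ 'm) \<Rightarrow> (real ^ 'n) set \<Rightarrow> real ^ 'n \<Rightarrow> bool" where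
  "weak_pareto_optimal f D xs \<longleftrightarrow> xs \<in> D \<and> \<not> (\<exists>x\<in>D. vec_less (f x) (f xs))"

definition pareto_optimal ::
    "(real ^ 'n \<Rightarrow> real ^ 'm) \<Rightarrow> (real ^ 'n) set \<Rightarrow> real ^ 'n \<Rightarrow> bool" where
  "pareto_optimal f D xs \<longleftrightarrow>
     xs \<in> D \<and> \<not> (\<exists>x\<in>D. f x \<le> f xs \<and> (\<exists>j. f x $ j < f xs $ j))"

(* B is a total function; only its values on strictly_feasible g matter.
   The component that blows up may depend on both the sequence z and the index i. *)

definition multiobjective_barrier ::
    "(real ^ 'n \<Rightarrow> real ^ 'p) \<Rightarrow> (real ^ 'n \<Rightarrow> real ^ 'm) \<Rightarrow> bool" where
  "multiobjective_barrier g B \<longleftrightarrow>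
     continuous_on (strictly_feasible g) B \<and>
     (\<forall>x\<in>strictly_feasible g. 0 \<le> B x) \<and>
     (\<forall>(z :: nat \<Rightarrow> real ^ 'n) i.
        (\<forall>k. z k \<in> strictly_feasible g) \<longrightarrow> (\<lambda>k. g (z k) $ i) \<longlonglongrightarrow> 0 \<longrightarrow>
        (\<exists>j. filterlim (\<lambda>k. B (z k) $ j) at_top sequentially))"

definition w_increasing :: "(real ^ 'm \<Rightarrow> real) \<Rightarrow> bool" where
  "w_increasing \<Phi> \<longleftrightarrow> (\<forall>u v. vec_less u v \<longrightarrow> \<Phi> u < \<Phi> v)"

definition s_increasing :: "(real ^ 'm \<Rightarrow> real) \<Rightarrow> bool" where
  "s_increasing \<Phi> \<longleftrightarrow> (\<forall>u v. u \<le> v \<longrightarrow> (\<exists>j. u $ j < v $ j) \<longrightarrow> \<Phi> u < \<Phi> v)"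

definition accumulation_point :: "(nat \<Rightarrow> 'a :: topological_space) \<Rightarrow> 'a \<Rightarrow> bool" where
  "accumulation_point x l \<longleftrightarrow> (\<exists>r :: nat \<Rightarrow> nat. strict_mono r \<and> (x \<circ> r) \<longlonglongrightarrow> l)"

end

theory Submission
  imports Defs
begin

text \<open>Continuity upgrades the strict monotonicity of \<open>\<Phi>\<close> to monotonicity for the componentwise \<open>\<le>\<close>.
  As \<open>B\<close> is nonnegative, for every strictly feasible \<open>y\<close> this gives
  \<open>\<Phi> (f (x k)) \<le> \<Phi> (f (x k) + \<tau> k *\<^sub>R B (x k)) \<le> \<Phi> (f y + \<tau> k *\<^sub>R B y)\<close>, and letting \<open>k\<close> tend to infinity along
  the convergent subsequence yields \<open>\<Phi> (f xbar) \<le> \<Phi> (f y)\<close>. The equality of the two infima extends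
  this to all feasible points, and minimizers of an increasing scalarization are Pareto optimal.\<close>

text \<open>Index types are nonempty, so inequality in all components supplies the single strict
  index required.\<close>

lemma s_increasing_imp_w_increasing:
  assumes "s_increasing \<Phi>"
  shows "w_increasing \<Phi>"
  using assms unfolding s_increasing_def w_increasing_def vec_less_def less_eq_vec_def
  by (meson less_imp_le)

text \<open>Shifting \<open>v\<close> by a small positive multiple of the all-ones vector makes it
  exceed \<open>u\<close> in every component; continuity then removes the shift at the price of
  strictness.\<close>

lemma w_increasing_mono:
  fixes \<Phi> :: "real ^ 'm \<Rightarrow> real"
  assumes w: "w_increasing \<Phi>" and cont: "continuous_on UNIV \<Phi>" and "u \<le> v"
  shows "\<Phi> u \<le> \<Phi> v"
proof -
  define w where "w k = v + inverse (real (Suc k)) *\<^sub>R (1 :: real ^ 'm)" for k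
  have "w \<longlonglongrightarrow> v + 0 *\<^sub>R 1"
    unfolding w_def by (intro tendsto_intros LIMSEQ_inverse_real_of_nat)
  then have "(\<lambda>k. \<Phi> (w k)) \<longlonglongrightarrow> \<Phi> v"
    using continuous_on_tendsto_compose[OF cont] by simp
  moreover have "\<Phi> u \<le> \<Phi> (w k)" for k
  proof -
    have "vec_less u (w k)"
      unfolding vec_less_def w_def
      using \<open>u \<le> v\<close> by (auto simp: less_eq_vec_def intro: le_less_trans)
    then show ?thesis using w by (simp add: w_increasing_def less_imp_le)
  qed
  ultimately show ?thesis by (intro LIMSEQ_le_const) auto
qed

lemma weak_pareto_optimal_if_arg_min:
  assumes "w_increasing \<Phi>" "is_arg_min (\<lambda>y. \<Phi> (f y)) (\<lambda>y. y \<in> D) z"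
  shows "weak_pareto_optimal f D z"
  using assms unfolding w_increasing_def is_arg_min_def weak_pareto_optimal_def by blast

lemma pareto_optimal_if_arg_min:
  assumes "s_increasing \<Phi>" "is_arg_min (\<lambda>y. \<Phi> (f y)) (\<lambda>y. y \<in> D) z"
  shows "pareto_optimal f D z"
  using assms unfolding s_increasing_def is_arg_min_def pareto_optimal_def by blast

text \<open>The limit \<open>xbar\<close> may lie outside \<open>S\<close>, where nothing is known
  about \<open>B\<close>. So the barrier term is discarded at the moving points before the limit is
  taken, and survives only at the fixed \<open>y\<close>, where it vanishes with
  \<open>\<tau>\<close>.\<close>

lemma accumulation_point_barrier_le:
  fixes f B :: "real ^ 'n \<Rightarrow> real ^ 'm"
  assumes f: "continuous_on UNIV f" and \<Phi>: "continuous_on UNIV \<Phi>" "w_increasing \<Phi>"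
    and B: "\<And>y. y \<in> S \<Longrightarrow> 0 \<le> B y"
    and \<tau>: "\<And>k. k \<ge> 1 \<Longrightarrow> 0 < \<tau> k" "\<tau> \<longlonglongrightarrow> 0"
    and x: "\<And>k. k \<ge> 1 \<Longrightarrow> is_arg_min (\<lambda>y. \<Phi> (f y + \<tau> k *\<^sub>R B y)) (\<lambda>y. y \<in> S) (x k)"
    and acc: "accumulation_point x xbar" and y: "y \<in> S"
  shows "\<Phi> (f xbar) \<le> \<Phi> (f y)"
proof -
  obtain r where r: "strict_mono r" "(\<lambda>k. x (r k)) \<longlonglongrightarrow> xbar"
    using acc by (auto simp: accumulation_point_def o_def)
  have "(\<lambda>k. f (x (r k))) \<longlonglongrightarrow> f xbar"
    using continuous_on_tendsto_compose[OF f r(2)] by simp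
  then have left: "(\<lambda>k. \<Phi> (f (x (r k)))) \<longlonglongrightarrow> \<Phi> (f xbar)"
    using continuous_on_tendsto_compose[OF \<Phi>(1)] by simp
  have "(\<lambda>k. \<tau> (r k)) \<longlonglongrightarrow> 0"
    using LIMSEQ_subseq_LIMSEQ[OF \<tau>(2) r(1)] by (simp add: o_def)
  then have "(\<lambda>k. f y + \<tau> (r k) *\<^sub>R B y) \<longlonglongrightarrow> f y + 0 *\<^sub>R B y"
    by (intro tendsto_intros)
  then have right: "(\<lambda>k. \<Phi> (f y + \<tau> (r k) *\<^sub>R B y)) \<longlonglongrightarrow> \<Phi> (f y)"
    using continuous_on_tendsto_compose[OF \<Phi>(1)] by simp
  \<comment> \<open>Nothing is assumed about \<open>\<tau>\<close> and \<open>x\<close> at index 0,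
    and \<open>r 0\<close> may be 0. Excluding \<open>k = 0\<close> does not affect the
    limits.\<close>
  have "\<Phi> (f (x (r k))) \<le> \<Phi> (f y + \<tau> (r k) *\<^sub>R B y)" if "k \<ge> 1" for k
  proof -
    have rk: "r k \<ge> 1" using seq_suble[OF r(1), of k] that by linarith
    note min = x[OF rk, unfolded is_arg_min_def]
    have "0 \<le> \<tau> (r k) *\<^sub>R B (x (r k))"
      using B \<tau>(1)[OF rk] min by (simp add: less_eq_vec_def)
    then have "\<Phi> (f (x (r k))) \<le> \<Phi> (f (x (r k)) + \<tau> (r k) *\<^sub>R B (x (r k)))"
      by (intro w_increasing_mono[OF \<Phi>(2,1)]) simp
    also have "\<dots> \<le> \<Phi> (f y + \<tau> (r k) *\<^sub>R B y)"
      using min y by (meson not_le)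
    finally show ?thesis .
  qed
  then show ?thesis
    by (intro LIMSEQ_le[OF left right]) blast
qed

theorem theorem4p2:
  fixes f :: "real ^ 'n \<Rightarrow> real ^ 'm"
    and g :: "real ^ 'n \<Rightarrow> real ^ 'p"
    and B :: "real ^ 'n \<Rightarrow> real ^ 'm"
    and \<Phi> :: "real ^ 'm \<Rightarrow> real"
    and \<tau> :: "nat \<Rightarrow> real"
    and x :: "nat \<Rightarrow> real ^ 'n"
    and xbar :: "real ^ 'n"
  assumes "continuous_on UNIV f"
    and "continuous_on UNIV g"
    and "strictly_feasible g \<noteq> {}"
    and "multiobjective_barrier g B"
    and "\<forall>k\<ge>1. 0 < \<tau> k"
    and "\<forall>k\<ge>1. \<tau> (k + 1) < \<tau> k"
    and "\<tau> \<longlonglongrightarrow> 0"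
    and "continuous_on UNIV \<Phi>"
    and "w_increasing \<Phi> \<or> s_increasing \<Phi>"
    and "bdd_below ((\<lambda>y. \<Phi> (f y)) ` feasible g)"
    and "(INF y\<in>strictly_feasible g. \<Phi> (f y)) = (INF y\<in>feasible g. \<Phi> (f y))"
    and "\<forall>k\<ge>1. is_arg_min (\<lambda>y. \<Phi> (f y + \<tau> k *\<^sub>R B y)) (\<lambda>y. y \<in> strictly_feasible g) (x k)"
    and "xbar \<in> feasible g"
    and "accumulation_point x xbar"
  shows "is_arg_min (\<lambda>y. \<Phi> (f y)) (\<lambda>y. y \<in> feasible g) xbar
    \<and> (w_increasing \<Phi> \<longrightarrow> weak_pareto_optimal f (feasible g) xbar)
    \<and> (s_increasing \<Phi> \<longrightarrow> pareto_optimal f (feasible g) xbar)"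
proof -
  have w: "w_increasing \<Phi>"
    using assms(9) s_increasing_imp_w_increasing by blast
  have "\<Phi> (f xbar) \<le> \<Phi> (f y)" if "y \<in> strictly_feasible g" for y
    using accumulation_point_barrier_le[OF assms(1,8) w, of "strictly_feasible g" B \<tau> x xbar y]
      assms(4,5,7,12,14) that unfolding multiobjective_barrier_def by blast
  then have "\<Phi> (f xbar) \<le> (INF y\<in>strictly_feasible g. \<Phi> (f y))"
    using assms(3) by (intro cINF_greatest)
  \<comment> \<open>Boundedness below guarantees that the real-valued \<open>INF\<close> over the
    feasible set is a genuine lower bound rather than an unspecified value.\<close>
  then have "\<Phi> (f xbar) \<le> \<Phi> (f y)" if "y \<in> feasible g" for y
    using assms(11) cINF_lower[OF assms(10) that] by linarith
  then have "is_arg_min (\<lambda>y. \<Phi> (f y)) (\<lambda>y. y \<in> feasible g) xbar"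
    using assms(13) by (auto simp: is_arg_min_def not_less)
  then show ?thesis
    using weak_pareto_optimal_if_arg_min pareto_optimal_if_arg_min by blast
qed

end
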